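(* Let $k>0$ be a real number. For every integer $n\ge 1$, $$\mathbb{H}F_{k,n-1}\,\mathbb{H}F_{k,n+1}-(\mathbb{H}F_{k,n})^2=(-1)^n\big[\,2k\,\mathbf{i}+2(k^2+1)\,\mathbf{j}+(k^3+2k)\,\mathbf{k}\,\big].$$
   Context: For a real number $k>0$, the $k$-Fibonacci numbers are defined by $F_{k,0}=0$, $F_{k,1}=1$, $F_{k,n+1}=kF_{k,n}+F_{k,n-1}$ for $n\ge1$. The hyperbolic quaternions form the real four-dimensional algebra with basis $1,\mathbf{i},\mathbf{j},\mathbf{k}$, unit $1$, and bilinear (non-commutative) product determined by $\mathbf{i}^2=\mathbf{j}^2=\mathbf{k}^2=1$, $\mathbf{i}\mathbf{j}=\mathbf{k}=-\mathbf{j}\mathbf{i}$, $\mathbf{j}\mathbf{k}=\mathbf{i}=-\mathbf{k}\mathbf{j}$, $\mathbf{k}\mathbf{i}=\mathbf{j}=-\mathbf{i}\mathbf{k}$. The unit $\mathbf{k}$ is distinct from the real parameter $k$. The $n$-th hyperbolic $k$-Fibonacci quaternion is $\mathbb{H}F_{k,n}=F_{k,n}+\mathbf{i}F_{k,n+1}+\mathbf{j}F_{k,n+2}+\mathbf{k}F_{k,n+3}$. *)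

theory Defs
  imports Complex_Main
begin

text \<open>The product of hyperbolic quaternions is not associative (\<open>i (i j) = - j\<close>, whereas
  \<open>(i i) j = j\<close>), so the type can be given none of the ring classes: it is a real vector space with
  a separate multiplication and unit.\<close>

datatype hquat = HQuat (hRe: real) (hIm1: real) (hIm2: real) (hIm3: real)

lemma hquat_eq_iff:
  "x = y \<longleftrightarrow> hRe x = hRe y \<and> hIm1 x = hIm1 y \<and> hIm2 x = hIm2 y \<and> hIm3 x = hIm3 y"
  by (cases x; cases y) simp

instantiation hquat :: real_vector
begin

definition zero_hquat :: hquat where
  "0 = HQuat 0 0 0 0"

definition plus_hquat :: "hquat \<Rightarrow> hquat \<Rightarrow> hquat" where
  "x + y = HQuat (hRe x + hRe y) (hIm1 x + hIm1 y) (hIm2 x + hIm2 y) (hIm3 x + hIm3 y)"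

definition uminus_hquat :: "hquat \<Rightarrow> hquat" where
  "- x = HQuat (- hRe x) (- hIm1 x) (- hIm2 x) (- hIm3 x)"

definition minus_hquat :: "hquat \<Rightarrow> hquat \<Rightarrow> hquat" where
  "x - y = HQuat (hRe x - hRe y) (hIm1 x - hIm1 y) (hIm2 x - hIm2 y) (hIm3 x - hIm3 y)"

definition scaleR_hquat :: "real \<Rightarrow> hquat \<Rightarrow> hquat" where
  "c *\<^sub>R x = HQuat (c * hRe x) (c * hIm1 x) (c * hIm2 x) (c * hIm3 x)"

instance
  by standard
    (simp_all add: hquat_eq_iff zero_hquat_def plus_hquat_def uminus_hquat_def minus_hquat_def
      scaleR_hquat_def algebra_simps)

end

instantiation hquat :: "{one, times}"
begin

definition one_hquat :: hquat where
  "1 = HQuat 1 0 0 0"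

text \<open>The coordinate formula is the bilinear extension of the multiplication table; see
  \<open>hquat_mult_table\<close> and the bilinearity lemmas below. All three imaginary units square to
  \<open>+ 1\<close>, whence the plus signs in the real part.\<close>

definition times_hquat :: "hquat \<Rightarrow> hquat \<Rightarrow> hquat" where
  "x * y = HQuat
     (hRe x * hRe y + hIm1 x * hIm1 y + hIm2 x * hIm2 y + hIm3 x * hIm3 y)
     (hRe x * hIm1 y + hIm1 x * hRe y + hIm2 x * hIm3 y - hIm3 x * hIm2 y)
     (hRe x * hIm2 y + hIm2 x * hRe y + hIm3 x * hIm1 y - hIm1 x * hIm3 y)
     (hRe x * hIm3 y + hIm3 x * hRe y + hIm1 x * hIm2 y - hIm2 x * hIm1 y)"

instance ..

end

instance hquat :: power ..

definition hi :: hquat where "hi = HQuat 0 1 0 0"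
definition hj :: hquat where "hj = HQuat 0 0 1 0"
definition hk :: hquat where "hk = HQuat 0 0 0 1"

lemmas hquat_defs = hquat_eq_iff zero_hquat_def plus_hquat_def uminus_hquat_def minus_hquat_def
  scaleR_hquat_def one_hquat_def times_hquat_def hi_def hj_def hk_def

lemma hquat_basis_expansion:
  "x = hRe x *\<^sub>R 1 + hIm1 x *\<^sub>R hi + hIm2 x *\<^sub>R hj + hIm3 x *\<^sub>R hk"
  by (simp add: hquat_defs)

lemma hquat_basis_independent:
  assumes "a *\<^sub>R 1 + b *\<^sub>R hi + c *\<^sub>R hj + d *\<^sub>R hk = 0"
  shows "a = 0 \<and> b = 0 \<and> c = 0 \<and> d = 0"
  using assms by (simp add: hquat_defs)

lemma hquat_mult_table:
  "hi * hi = 1" "hj * hj = 1" "hk * hk = 1"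
  "hi * hj = hk" "hj * hi = - hk"
  "hj * hk = hi" "hk * hj = - hi"
  "hk * hi = hj" "hi * hk = - hj"
  by (simp_all add: hquat_defs)

lemma hquat_mult_one:
  fixes x :: hquat
  shows "1 * x = x" "x * 1 = x"
  by (simp_all add: hquat_defs)

lemma hquat_mult_bilinear:
  fixes x y z :: hquat
  shows "(x + y) * z = x * z + y * z" "x * (y + z) = x * y + x * z"
    "(c *\<^sub>R x) * y = c *\<^sub>R (x * y)" "x * (c *\<^sub>R y) = c *\<^sub>R (x * y)"
  by (simp_all add: hquat_defs algebra_simps)

lemma hquat_power2:
  fixes x :: hquat
  shows "x\<^sup>2 = x * x"
  by (simp add: numeral_2_eq_2 hquat_mult_one)

fun kfib :: "real \<Rightarrow> nat \<Rightarrow> real" where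
  "kfib k 0 = 0"
| "kfib k (Suc 0) = 1"
| "kfib k (Suc (Suc n)) = k * kfib k (Suc n) + kfib k n"

definition HF :: "real \<Rightarrow> nat \<Rightarrow> hquat" where
  "HF k n = kfib k n *\<^sub>R 1 + kfib k (n + 1) *\<^sub>R hi + kfib k (n + 2) *\<^sub>R hj + kfib k (n + 3) *\<^sub>R hk"

end

theory Submission
  imports Defs
begin

text \<open>Every coordinate of the left-hand side is a quadratic form in \<open>a = F\<^sub>n\<^sub>-\<^sub>1\<close> and \<open>b = F\<^sub>n\<close>, and
  equals a polynomial in \<open>k\<close> times the form \<open>a (k b + a) - b\<^sup>2\<close>, which is \<open>(-1)\<^sup>n\<close> by Cassini's
  identity.\<close>

text \<open>Raising the index by one flips the sign: expand the top term and one factor of the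
  square by the recurrence, and the products with factor \<open>k\<close> cancel.\<close>

lemma kfib_cassini:
  "kfib k m * kfib k (Suc (Suc m)) - (kfib k (Suc m))\<^sup>2 = (-1) ^ Suc m"
proof (induction m)
  case 0
  show ?case by simp
next
  case (Suc m)
  have "kfib k (Suc m) * kfib k (Suc (Suc (Suc m))) - (kfib k (Suc (Suc m)))\<^sup>2
    = - (kfib k m * kfib k (Suc (Suc m)) - (kfib k (Suc m))\<^sup>2)"
    by (simp add: power2_eq_square algebra_simps)
  then show ?case
    unfolding Suc.IH by simp
qed

theorem theorem2p8:
  fixes k :: real and n :: nat
  assumes "k > 0" and "n \<ge> 1"
  shows "HF k (n - 1) * HF k (n + 1) - (HF k n)\<^sup>2
    = (-1) ^ n *\<^sub>R ((2 * k) *\<^sub>R hi + (2 * (k\<^sup>2 + 1)) *\<^sub>R hj + (k ^ 3 + 2 * k) *\<^sub>R hk)"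
proof -
  \<comment> \<open>This turns the truncated \<open>n - 1\<close> into \<open>m\<close>.\<close>
  obtain m where n: "n = Suc m"
    using assms(2) by (cases n) auto
  define a b where "a = kfib k m" and "b = kfib k (Suc m)"
  have sign: "(-1) ^ n = a * (k * b + a) - b\<^sup>2"
    using kfib_cassini[of k m] by (simp add: n a_def b_def)
  show ?thesis
    \<comment> \<open>\<open>sign\<close> goes first, while the power still reads
      \<open>(-1) ^ n\<close>. The recurrence then reduces all entries, up to index
      \<open>m + 5\<close>, to \<open>a\<close> and \<open>b\<close>, leaving polynomial
      identities.\<close>
    unfolding sign unfolding n
    by (simp add: HF_def hquat_power2 hquat_defs numeral_2_eq_2 numeral_3_eq_3
        flip: a_def b_def) (simp add: algebra_simps)
qed

end
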